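(* Let $f_1,f_2:\mathbb{R}^N\to\mathbb{R}^N$ be $C^1$ functions and define, for $t\ge0$ and $(\mathbf{q},\mathbf{v})\in\mathbb{R}^{2N}$, $$\Xi^{(1)}_t(\mathbf{q},\mathbf{v})=(\mathbf{q},\mathbf{v}+t f_2(\mathbf{q})),\qquad\Xi^{(2)}_t(\mathbf{q},\mathbf{v})=(\mathbf{q}+t f_1(\mathbf{v}),\mathbf{v}).$$ For any $\delta_1,\delta_2>0$ and $n\in\mathbb{N}$ let $$\hat{\mathcal{S}}_{n,\delta_1,\delta_2}=\bigl(\Xi^{(1)}_{\delta_1}\circ\Xi^{(2)}_{\delta_2}\circ\Xi^{(1)}_{\delta_1}\bigr)^n.$$ Then: (i) $\hat{\mathcal{S}}_{n,\delta_1,\delta_2}$ is volume-preserving, i.e. $|\det\nabla\hat{\mathcal{S}}_{n,\delta_1,\delta_2}(\mathbf{z})|=1$ for all $\mathbf{z}\in\mathbb{R}^{2N}$. (ii) If furthermore $f_1(-\mathbf{v})=-f_1(\mathbf{v})$ for every $\mathbf{v}\in\mathbb{R}^N$, then $\hat{\mathcal{S}}_{n,\delta_1,\delta_2}$ is reversible with respect to the momentum-flip involution $R(\mathbf{q},\mathbf{v})=(\mathbf{q},-\mathbf{v})$.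
   Context: A $C^1$ map $\hat S:\mathbb{R}^{2N}\to\mathbb{R}^{2N}$ is reversible with respect to a linear invertible map $R$ if $\hat S$ is invertible and $R\circ\hat S=\hat S^{-1}\circ R$ on $\mathbb{R}^{2N}$. The maps $\Xi^{(1)}_t,\Xi^{(2)}_t$ are the time-$t$ solution maps of $\dot{\mathbf{q}}=0,\dot{\mathbf{v}}=f_2(\mathbf{q})$ and $\dot{\mathbf{q}}=f_1(\mathbf{v}),\dot{\mathbf{v}}=0$ respectively. *)

theory Defs
  imports "HOL-Analysis.Analysis"
begin

(* The phase space R^(2N) is real ^ ('n + 'n) with N = CARD('n), rather than the product type
   (real ^ 'n) \<times> (real ^ 'n), so that gradients are square matrices with a library determinant.
   The coordinates Inl i hold the position q and the coordinates Inr i the velocity v. *)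

type_synonym 'n phase = "real ^ ('n + 'n)"

definition phase_pt :: "real ^ 'n \<Rightarrow> real ^ 'n \<Rightarrow> 'n::finite phase" where
  "phase_pt q v = (\<chi> k. case k of Inl i \<Rightarrow> q $ i | Inr i \<Rightarrow> v $ i)"

definition pos :: "'n::finite phase \<Rightarrow> real ^ 'n" where
  "pos z = (\<chi> i. z $ Inl i)"

definition vel :: "'n::finite phase \<Rightarrow> real ^ 'n" where
  "vel z = (\<chi> i. z $ Inr i)"

lemma pos_phase_pt [simp]: "pos (phase_pt q v) = q"
  by (simp add: pos_def phase_pt_def vec_eq_iff)

lemma vel_phase_pt [simp]: "vel (phase_pt q v) = v"
  by (simp add: vel_def phase_pt_def vec_eq_iff)

lemma phase_pt_pos_vel [simp]: "phase_pt (pos z) (vel z) = z"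
  by (simp add: pos_def vel_def phase_pt_def vec_eq_iff split: sum.split)

definition C1_map :: "(real ^ 'm \<Rightarrow> real ^ 'k) \<Rightarrow> bool" where
  "C1_map f \<longleftrightarrow>
     (\<forall>x. f differentiable (at x)) \<and> continuous_on UNIV (\<lambda>x. jacobian f (at x))"

definition Xi1 :: "(real ^ 'n \<Rightarrow> real ^ 'n) \<Rightarrow> real \<Rightarrow> 'n::finite phase \<Rightarrow> 'n phase" where
  "Xi1 f2 t z = phase_pt (pos z) (vel z + t *\<^sub>R f2 (pos z))"

definition Xi2 :: "(real ^ 'n \<Rightarrow> real ^ 'n) \<Rightarrow> real \<Rightarrow> 'n::finite phase \<Rightarrow> 'n phase" where
  "Xi2 f1 t z = phase_pt (pos z + t *\<^sub>R f1 (vel z)) (vel z)"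

definition S_hat ::
  "(real ^ 'n \<Rightarrow> real ^ 'n) \<Rightarrow> (real ^ 'n \<Rightarrow> real ^ 'n) \<Rightarrow> nat \<Rightarrow> real \<Rightarrow> real
     \<Rightarrow> 'n::finite phase \<Rightarrow> 'n phase" where
  "S_hat f1 f2 n \<delta>1 \<delta>2 = (Xi1 f2 \<delta>1 \<circ> Xi2 f1 \<delta>2 \<circ> Xi1 f2 \<delta>1) ^^ n"

(* Differentiability is required explicitly: jacobian is an unspecified matrix at points
   where the map is not differentiable. *)
definition volume_preserving :: "(real ^ 'm \<Rightarrow> real ^ 'm) \<Rightarrow> bool" where
  "volume_preserving S \<longleftrightarrow>
     (\<forall>z. S differentiable (at z) \<and> \<bar>det (jacobian S (at z))\<bar> = 1)"

(* Bijectivity of S is required explicitly: inv S is a genuine inverse only then. *)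
definition reversible_wrt ::
  "(real ^ 'm \<Rightarrow> real ^ 'm) \<Rightarrow> (real ^ 'm \<Rightarrow> real ^ 'm) \<Rightarrow> bool" where
  "reversible_wrt R S \<longleftrightarrow>
     linear R \<and> bij R \<and> C1_map S \<and> bij S \<and> R \<circ> S = inv S \<circ> R"

definition momentum_flip :: "'n::finite phase \<Rightarrow> 'n phase" where
  "momentum_flip z = phase_pt (pos z) (- vel z)"

end

theory Submission
  imports Defs
begin

text \<open>
  Call \<open>S\<close> reversed by \<open>R\<close> when \<open>S \<circ> R \<circ> S = R\<close>. This identity is inherited by palindromic
  compositions such as \<open>A \<circ> B \<circ> A\<close> and by powers, and for an involution \<open>R\<close> it makes \<open>S\<close> bijective
  with inverse \<open>R \<circ> S \<circ> R\<close>. Both shears satisfy it for the momentum flip, the drift because \<open>f1\<close> is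
  odd.

  It also yields the determinants: the derivative of a shear is a shear whose force is linear, hence
  odd, so that it is always reversed by the flip, and \<open>L R L = R\<close> forces \<open>(det L)\<^sup>2 = 1\<close>.
\<close>

section \<open>Jacobians and closure properties of \<open>C1_map\<close>\<close>

lemma jacobian_eq:
  fixes f :: "real ^ 'm \<Rightarrow> real ^ 'k"
  assumes "(f has_derivative f') (at x)"
  shows "jacobian f (at x) = matrix f'"
  using frechet_derivative_at[OF assms] by (simp add: jacobian_def)

lemma jacobian_compose:
  fixes f :: "real ^ 'm \<Rightarrow> real ^ 'k" and g :: "real ^ 'k \<Rightarrow> real ^ 'l"
  assumes "f differentiable (at x)" and "g differentiable (at (f x))"
  shows "jacobian (g \<circ> f) (at x) = jacobian g (at (f x)) ** jacobian f (at x)"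
proof -
  have "((g \<circ> f) has_derivative (\<lambda>h. jacobian g (at (f x)) *v h) \<circ> (\<lambda>h. jacobian f (at x) *v h)) (at x)"
    using assms by (intro diff_chain_at) (simp_all add: jacobian_works)
  then have "jacobian (g \<circ> f) (at x) = matrix ((\<lambda>h. jacobian g (at (f x)) *v h) \<circ> (\<lambda>h. jacobian f (at x) *v h))"
    by (rule jacobian_eq)
  then show ?thesis
    by (simp add: matrix_compose matrix_vector_mul_linear)
qed

lemma C1_map_compose:
  fixes f :: "real ^ 'm \<Rightarrow> real ^ 'k" and g :: "real ^ 'k \<Rightarrow> real ^ 'l"
  assumes "C1_map g" and "C1_map f"
  shows "C1_map (g \<circ> f)"
  unfolding C1_map_def
proof (intro conjI allI)
  have df: "f differentiable (at x)" and dg: "g differentiable (at y)" for x y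
    using assms by (auto simp: C1_map_def)
  show "(g \<circ> f) differentiable (at x)" for x
    by (intro differentiable_chain_at df dg)
  have cf: "continuous_on UNIV (\<lambda>x. jacobian f (at x))"
    using assms by (simp add: C1_map_def)
  \<comment> \<open>The chain rule evaluates the Jacobian of \<open>g\<close> at \<open>f x\<close>,
    so continuity of \<open>f\<close> itself enters.\<close>
  have "continuous_on UNIV f"
    using df by (meson differentiable_at_imp_differentiable_on differentiable_imp_continuous_on)
  then have cg: "continuous_on UNIV (\<lambda>x. jacobian g (at (f x)))"
    using assms(1) continuous_on_compose2[of UNIV "\<lambda>y. jacobian g (at y)" UNIV f]
    by (simp add: C1_map_def)
  \<comment> \<open>Continuity is checked entrywise: each entry is a finite sum of products of
    continuous entries.\<close>
  have "continuous_on UNIV (\<lambda>x. jacobian g (at (f x)) ** jacobian f (at x))"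
    unfolding matrix_matrix_mult_def
    by (intro continuous_on_vec_lambda continuous_intros continuous_on_component cf cg)
  then show "continuous_on UNIV (\<lambda>x. jacobian (g \<circ> f) (at x))"
    by (simp add: jacobian_compose df dg)
qed

lemma C1_map_linear:
  fixes f :: "real ^ 'm \<Rightarrow> real ^ 'k"
  assumes "linear f"
  shows "C1_map f"
proof -
  have "(f has_derivative f) (at x)" for x
    using assms by (simp add: linear_imp_has_derivative)
  then have "f differentiable (at x)" and "jacobian f (at x) = matrix f" for x
    by (auto intro: differentiableI jacobian_eq)
  then show ?thesis
    by (simp add: C1_map_def)
qed

lemma C1_map_add:
  fixes f g :: "real ^ 'm \<Rightarrow> real ^ 'k"
  assumes "C1_map f" and "C1_map g"
  shows "C1_map (\<lambda>x. f x + g x)"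
  unfolding C1_map_def
proof (intro conjI allI)
  have df: "f differentiable (at x)" and dg: "g differentiable (at x)" for x
    using assms by (auto simp: C1_map_def)
  show "(\<lambda>x. f x + g x) differentiable (at x)" for x
    using df dg by (rule differentiable_add)
  have "((\<lambda>x. f x + g x) has_derivative (\<lambda>h. (jacobian f (at x) + jacobian g (at x)) *v h)) (at x)" for x
    using has_derivative_add[of f _ "at x" g] df dg
    by (simp add: jacobian_works matrix_vector_mult_add_rdistrib)
  from jacobian_eq[OF this]
  have "jacobian (\<lambda>x. f x + g x) (at x) = jacobian f (at x) + jacobian g (at x)" for x
    by simp
  then show "continuous_on UNIV (\<lambda>x. jacobian (\<lambda>x. f x + g x) (at x))"
    using assms by (simp add: C1_map_def continuous_on_add)
qed

lemma C1_map_funpow: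
  fixes S :: "real ^ 'm \<Rightarrow> real ^ 'm"
  assumes "C1_map S"
  shows "C1_map (S ^^ n)"
proof (induction n)
  case 0
  show ?case by (simp add: C1_map_linear linear_ident)
next
  case (Suc n)
  then show ?case unfolding funpow.simps by (rule C1_map_compose[OF assms])
qed

section \<open>Volume preservation under composition and iteration\<close>

lemma volume_preserving_compose:
  fixes S T :: "real ^ 'm \<Rightarrow> real ^ 'm"
  assumes "volume_preserving S" and "volume_preserving T"
  shows "volume_preserving (S \<circ> T)"
  using assms unfolding volume_preserving_def
  by (simp add: differentiable_chain_at jacobian_compose det_mul abs_mult)

lemma volume_preserving_funpow:
  fixes S :: "real ^ 'm \<Rightarrow> real ^ 'm"
  assumes "volume_preserving S"
  shows "volume_preserving (S ^^ n)"
proof (induction n)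
  case 0
  have "jacobian (\<lambda>x. x) (at x) = mat 1" for x :: "real ^ 'm"
    using jacobian_eq[OF has_derivative_ident] by (simp add: matrix_id_mat_1 flip: id_def)
  then show ?case
    by (simp add: volume_preserving_def id_def)
next
  case (Suc n)
  then show ?case unfolding funpow.simps by (rule volume_preserving_compose[OF assms])
qed

section \<open>Smoothness and derivatives of the two shears\<close>

lemma linear_pos: "linear pos"
  by (rule linearI) (simp_all add: pos_def vec_eq_iff)

lemma linear_vel: "linear vel"
  by (rule linearI) (simp_all add: vel_def vec_eq_iff)

lemma phase_pt_add: "phase_pt q v + phase_pt q' v' = phase_pt (q + q') (v + v')"
  by (auto simp: phase_pt_def vec_eq_iff split: sum.split)

lemma phase_pt_scaleR: "t *\<^sub>R phase_pt q v = phase_pt (t *\<^sub>R q) (t *\<^sub>R v)"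
  by (auto simp: phase_pt_def vec_eq_iff split: sum.split)

text \<open>Splitting off the identity leaves the force between two linear maps, so that smoothness
  and derivatives of the shear follow from the rules for sums and compositions.
  \<open>Xi2_eq\<close> serves the same end.\<close>

lemma Xi1_eq: "Xi1 f t z = z + ((\<lambda>w. phase_pt 0 (t *\<^sub>R w)) \<circ> (f \<circ> pos)) z"
proof -
  have "z + phase_pt 0 (t *\<^sub>R f (pos z)) = phase_pt (pos z) (vel z) + phase_pt 0 (t *\<^sub>R f (pos z))"
    by simp
  then show ?thesis unfolding phase_pt_add by (simp add: Xi1_def)
qed

lemma Xi2_eq: "Xi2 f t z = z + ((\<lambda>w. phase_pt (t *\<^sub>R w) 0) \<circ> (f \<circ> vel)) z"
proof -
  have "z + phase_pt (t *\<^sub>R f (vel z)) 0 = phase_pt (pos z) (vel z) + phase_pt (t *\<^sub>R f (vel z)) 0"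
    by simp
  then show ?thesis unfolding phase_pt_add by (simp add: Xi2_def)
qed

lemma linear_kick: "linear (\<lambda>w. phase_pt 0 (t *\<^sub>R w))"
  by (rule linearI) (simp_all add: phase_pt_add phase_pt_scaleR scaleR_add_right mult.commute)

lemma linear_drift: "linear (\<lambda>w. phase_pt (t *\<^sub>R w) 0)"
  by (rule linearI) (simp_all add: phase_pt_add phase_pt_scaleR scaleR_add_right mult.commute)

lemma C1_map_Xi1: "C1_map f \<Longrightarrow> C1_map (Xi1 f t)"
  unfolding Xi1_eq[abs_def]
  by (intro C1_map_add C1_map_compose) (simp_all add: C1_map_linear linear_kick linear_pos linear_ident)

lemma C1_map_Xi2: "C1_map f \<Longrightarrow> C1_map (Xi2 f t)"
  unfolding Xi2_eq[abs_def]
  by (intro C1_map_add C1_map_compose) (simp_all add: C1_map_linear linear_drift linear_vel linear_ident)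

text \<open>Expressing the derivative through \<open>Xi1\<close> again makes
  \<open>Xi1_reversed\<close> applicable to it; no block matrix has to be written down.\<close>

lemma has_derivative_Xi1:
  assumes "(f has_derivative f') (at (pos z))"
  shows "(Xi1 f t has_derivative Xi1 f' t) (at z)"
  unfolding Xi1_eq[abs_def]
  by (intro has_derivative_add has_derivative_ident diff_chain_at assms
      linear_imp_has_derivative linear_pos linear_kick)

lemma has_derivative_Xi2:
  assumes "(f has_derivative f') (at (vel z))"
  shows "(Xi2 f t has_derivative Xi2 f' t) (at z)"
  unfolding Xi2_eq[abs_def]
  by (intro has_derivative_add has_derivative_ident diff_chain_at assms
      linear_imp_has_derivative linear_vel linear_drift)

section \<open>The momentum flip and maps reversed by it\<close>

lemma linear_momentum_flip: "linear momentum_flip"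
  by (rule linearI)
    (simp_all add: momentum_flip_def phase_pt_add phase_pt_scaleR
      linear_add[OF linear_pos] linear_add[OF linear_vel] linear_cmul[OF linear_pos] linear_cmul[OF linear_vel])

lemma momentum_flip_momentum_flip: "momentum_flip (momentum_flip z) = z"
  by (simp add: momentum_flip_def)

text \<open>The flip keeps the position and negates the first kick, so the second kick, with the
  same force, cancels it.\<close>

lemma Xi1_reversed: "Xi1 f t (momentum_flip (Xi1 f t z)) = momentum_flip z"
  by (simp add: Xi1_def momentum_flip_def)

text \<open>After the flip the drift runs with velocity \<open>- v\<close>; oddness makes its
  displacement the negative of the first one.\<close>

lemma Xi2_reversed:
  assumes "\<And>v. f (- v) = - f v"
  shows "Xi2 f t (momentum_flip (Xi2 f t z)) = momentum_flip z"
  by (simp add: Xi2_def momentum_flip_def assms)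

lemma funpow_reversed:
  assumes "\<And>z. S (R (S z)) = R z"
  shows "(S ^^ n) (R ((S ^^ n) z)) = R z"
proof (induction n)
  case (Suc n)
  \<comment> \<open>The left power gives up its innermost factor and the right power its outermost,
    so the two copies of \<open>S\<close> meet around \<open>R\<close>.\<close>
  have "(S ^^ Suc n) (R ((S ^^ Suc n) z)) = (S ^^ n) (S (R (S ((S ^^ n) z))))"
    by (simp add: funpow_swap1)
  then show ?case by (simp add: assms Suc)
qed simp

lemma abs_det_reversed:
  fixes L R :: "real ^ 'm \<Rightarrow> real ^ 'm"
  assumes "linear L" and "linear R"
    and involution: "\<And>z. R (R z) = z"
    and reversed: "\<And>z. L (R (L z)) = R z"
  shows "\<bar>det (matrix L)\<bar> = 1"
proof -
  have "R \<circ> R = id" "L \<circ> (R \<circ> L) = R"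
    using involution reversed by auto
  then have "matrix R ** matrix R = mat 1" "matrix L ** (matrix R ** matrix L) = matrix R"
    using assms(1,2) by (metis matrix_compose linear_compose matrix_id_mat_1)+
  then have "det (matrix R) * det (matrix R) = 1"
    and "det (matrix L) * (det (matrix R) * det (matrix L)) = det (matrix R)"
    by (metis det_mul det_I)+
  \<comment> \<open>The determinant of \<open>R\<close> squares to 1, hence is nonzero and cancels
    from the second equation.\<close>
  then have "(det (matrix L))\<^sup>2 = 1"
    by algebra
  then show ?thesis
    by (auto simp: power2_eq_1_iff)
qed

section \<open>Unit determinants of the shears\<close>

lemma volume_preserving_Xi1:
  assumes "C1_map f"
  shows "volume_preserving (Xi1 f t)"
  unfolding volume_preserving_def
proof (intro allI conjI)
  fix z
  obtain f' where f': "(f has_derivative f') (at (pos z))"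
    using assms by (auto simp: C1_map_def differentiable_def)
  note deriv = has_derivative_Xi1[OF f', of t]
  show "Xi1 f t differentiable (at z)"
    using deriv by (rule differentiableI)
  show "\<bar>det (jacobian (Xi1 f t) (at z))\<bar> = 1"
    unfolding jacobian_eq[OF deriv]
    by (rule abs_det_reversed[where R = momentum_flip])
      (simp_all add: has_derivative_linear[OF deriv] linear_momentum_flip
        momentum_flip_momentum_flip Xi1_reversed)
qed

lemma volume_preserving_Xi2:
  assumes "C1_map f"
  shows "volume_preserving (Xi2 f t)"
  unfolding volume_preserving_def
proof (intro allI conjI)
  fix z
  obtain f' where f': "(f has_derivative f') (at (vel z))"
    using assms by (auto simp: C1_map_def differentiable_def)
  note deriv = has_derivative_Xi2[OF f', of t]
  show "Xi2 f t differentiable (at z)"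
    using deriv by (rule differentiableI)
  \<comment> \<open>Linearity of the derivative supplies the oddness that
    \<open>Xi2_reversed\<close> asks of the force.\<close>
  have odd: "f' (- v) = - f' v" for v
    by (rule linear_neg[OF has_derivative_linear[OF f']])
  show "\<bar>det (jacobian (Xi2 f t) (at z))\<bar> = 1"
    unfolding jacobian_eq[OF deriv]
    by (rule abs_det_reversed[where R = momentum_flip])
      (simp_all add: has_derivative_linear[OF deriv] linear_momentum_flip
        momentum_flip_momentum_flip Xi2_reversed odd)
qed

section \<open>Reversibility and the splitting scheme\<close>

lemma reversible_wrt_involution:
  assumes "linear R" and "C1_map S"
    and involution: "\<And>z. R (R z) = z"
    and reversed: "\<And>z. S (R (S z)) = R z"
  shows "reversible_wrt R S"
proof -
  have "bij R"
    using involution by (rule involuntory_imp_bij)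
  have left_inv: "(R \<circ> S \<circ> R) \<circ> S = id" and right_inv: "S \<circ> (R \<circ> S \<circ> R) = id"
    using involution reversed by (auto simp: fun_eq_iff)
  then have "bij S"
    using o_bij by blast
  have "inv S = R \<circ> S \<circ> R"
    using left_inv right_inv by (rule inv_unique_comp[rotated])
  then have "R \<circ> S = inv S \<circ> R"
    using involution by (auto simp: fun_eq_iff)
  then show ?thesis
    using assms(1,2) \<open>bij R\<close> \<open>bij S\<close> by (simp add: reversible_wrt_def)
qed

theorem theorem4p7:
  fixes f1 f2 :: "real ^ 'n \<Rightarrow> real ^ 'n"
  assumes "C1_map f1" and "C1_map f2"
  shows "\<forall>\<delta>1 > 0. \<forall>\<delta>2 > 0. \<forall>n :: nat.
           volume_preserving (S_hat f1 f2 n \<delta>1 \<delta>2) \<and>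
           ((\<forall>v. f1 (- v) = - f1 v) \<longrightarrow>
              reversible_wrt momentum_flip (S_hat f1 f2 n \<delta>1 \<delta>2))"
proof (intro allI impI conjI)
  fix \<delta>1 \<delta>2 :: real and n :: nat
  show "volume_preserving (S_hat f1 f2 n \<delta>1 \<delta>2)"
    unfolding S_hat_def
    by (intro volume_preserving_funpow volume_preserving_compose
        volume_preserving_Xi1 volume_preserving_Xi2 assms)
  assume odd: "\<forall>v. f1 (- v) = - f1 v"
  show "reversible_wrt momentum_flip (S_hat f1 f2 n \<delta>1 \<delta>2)"
    unfolding S_hat_def
  proof (intro reversible_wrt_involution linear_momentum_flip momentum_flip_momentum_flip
      funpow_reversed C1_map_funpow C1_map_compose C1_map_Xi1 C1_map_Xi2 assms)
    \<comment> \<open>The palindrome collapses from its centre: with kick \<open>A\<close>, drift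
      \<open>B\<close> and flip \<open>R\<close>, the word \<open>A B A R A B A\<close> shrinks to
      \<open>A B R B A\<close>, then \<open>A R A\<close>, then \<open>R\<close>.\<close>
    show "(Xi1 f2 \<delta>1 \<circ> Xi2 f1 \<delta>2 \<circ> Xi1 f2 \<delta>1) (momentum_flip
        ((Xi1 f2 \<delta>1 \<circ> Xi2 f1 \<delta>2 \<circ> Xi1 f2 \<delta>1) z)) = momentum_flip z" for z
      by (simp add: Xi1_reversed Xi2_reversed odd)
  qed
qed

end
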